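(* Let $I$ be a monomial ideal and $>_I$ a total ordering on $\mathcal G(I)$. Suppose that for all $\sigma\subseteq\mathcal G(I)$ and all $m,m'\in\mathcal G(I)$: whenever $m'>_I m$ and $m$ is a true gap of $\sigma$, the monomial $m$ is a true gap of $\sigma\cup\{m'\}$. Then $I$ is bridge-friendly with respect to $>_I$.
   Context: $I$ is a monomial ideal in a polynomial ring over a field, $\mathcal G(I)$ is its set of minimal monomial generators, $>_I$ a total ordering on $\mathcal G(I)$; $\operatorname{lcm}(\sigma)$ is the least common multiple of the elements of $\sigma\subseteq\mathcal G(I)$. $m\in\mathcal G(I)$ is a bridge of $\sigma$ if $m\in\sigma$ and $\operatorname{lcm}(\sigma\setminus m)=\operatorname{lcm}(\sigma)$. $m$ is a gap of $\sigma$ if $m\notin\sigma$ and $\operatorname{lcm}(\sigma\cup m)=\operatorname{lcm}(\sigma)$. $m$ is a true gap of $\sigma$ if it is a gap of $\sigma$ and every bridge $m''$ of $\sigma\cup m$ with $m>_I m''$ is already a bridge of $\sigma$. $\operatorname{sb}(\sigma)$ is the $>_I$-smallest bridge of $\sigma$ if one exists, and $\emptyset$ otherwise ($\sigma\setminus\emptyset=\sigma$). Barile-Macchia algorithm: start with $A=\emptyset$, $\Omega=\{\sigma\subseteq\mathcal G(I):|\sigma|\ge3\}$. (1) Pick $\sigma\in\Omega$ of maximal cardinality. (2) Replace $\Omega$ by $\Omega\setminus\{\sigma,\sigma\setminus\operatorname{sb}(\sigma)\}$; if $\operatorname{sb}(\sigma)\neq\emptyset$ add the directed edge $(\sigma,\sigma\setminus\operatorname{sb}(\sigma))$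 to $A$; if $\Omega\ne\emptyset$ return to (1). (3) Whenever two distinct edges $(\sigma,\sigma\setminus\operatorname{sb}(\sigma))$, $(\sigma',\sigma'\setminus\operatorname{sb}(\sigma'))$ of $A$ have the same target, remove the one whose smallest bridge is larger with respect to $>_I$. A subset $\sigma$ is potentially-type-2 if the edge $(\sigma,\sigma\setminus\operatorname{sb}(\sigma))$ is added to $A$ in step (2); it is type-2 if this edge remains in the final $A$. $I$ is bridge-friendly with respect to $>_I$ if all potentially-type-2 subsets are type-2. *)

theory Defs
  imports Complex_Main "HOL-Library.Poly_Mapping"
begin

text \<open>
  The polynomial ring over \<^typ>\<open>'k\<close> in the variables \<^typ>\<open>'x\<close> is the monoid algebra
  \<open>('x \<Rightarrow>\<^sub>0 nat) \<Rightarrow>\<^sub>0 'k\<close>; a monomial is represented by its exponent vector.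
\<close>

type_synonym 'x monom = "'x \<Rightarrow>\<^sub>0 nat"

abbreviation mon :: "'x monom \<Rightarrow> 'x monom \<Rightarrow>\<^sub>0 'k::field" where
  "mon m \<equiv> Poly_Mapping.single m 1"

text \<open>The ideals of a commutative ring are its submodules over itself.\<close>

definition monomial_ideal :: "('x monom \<Rightarrow>\<^sub>0 'k::field) set \<Rightarrow> bool" where
  "monomial_ideal I \<longleftrightarrow> (\<exists>M. I = module.span (*) (mon ` M))"

definition mdvd :: "'x monom \<Rightarrow> 'x monom \<Rightarrow> bool" where
  "mdvd m n \<longleftrightarrow> (\<exists>u. n = m + u)"

definition min_gens :: "('x monom \<Rightarrow>\<^sub>0 'k::field) set \<Rightarrow> 'x monom set" where
  "min_gens I = {m. mon m \<in> I \<and> (\<forall>n. mon n \<in> I \<and> mdvd n m \<longrightarrow> n = m)}"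

text \<open>On \<^typ>\<open>nat\<close> the supremum of the empty set is 0, so the least common multiple of \<open>{}\<close> is 1.\<close>

definition mlcm :: "('x::finite) monom set \<Rightarrow> 'x monom" where
  "mlcm \<sigma> = Abs_poly_mapping (\<lambda>i. SUP m\<in>\<sigma>. Poly_Mapping.lookup m i)"

definition bridge :: "('x::finite) monom set \<Rightarrow> 'x monom \<Rightarrow> bool" where
  "bridge \<sigma> m \<longleftrightarrow> m \<in> \<sigma> \<and> mlcm (\<sigma> - {m}) = mlcm \<sigma>"

definition gap :: "('x::finite) monom set \<Rightarrow> 'x monom \<Rightarrow> bool" where
  "gap \<sigma> m \<longleftrightarrow> m \<notin> \<sigma> \<and> mlcm (insert m \<sigma>) = mlcm \<sigma>"

text \<open>
  The total order \<open>>\<^sub>I\<close> is a strict order relation \<open>gt\<close>, where \<open>(a, b) \<in> gt\<close> means \<open>a >\<^sub>I b\<close>.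
\<close>

definition true_gap :: "('x::finite) monom rel \<Rightarrow> 'x monom set \<Rightarrow> 'x monom \<Rightarrow> bool" where
  "true_gap gt \<sigma> m \<longleftrightarrow> gap \<sigma> m \<and>
     (\<forall>n. bridge (insert m \<sigma>) n \<and> (m, n) \<in> gt \<longrightarrow> bridge \<sigma> n)"

text \<open>
  \<open>sb gt \<sigma>\<close> is the singleton of the smallest bridge, or empty if there is no bridge, so that
  \<open>\<sigma> - sb gt \<sigma>\<close> is always meaningful.
\<close>

definition sb :: "('x::finite) monom rel \<Rightarrow> 'x monom set \<Rightarrow> 'x monom set" where
  "sb gt \<sigma> = {m. bridge \<sigma> m \<and> (\<forall>n. bridge \<sigma> n \<and> n \<noteq> m \<longrightarrow> (n, m) \<in> gt)}"

type_synonym 'x edges = "('x monom set \<times> 'x monom set) set"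

text \<open>
  The algorithm leaves the choice of \<open>\<sigma>\<close> in step (1), and the order of the removals in step (3),
  open; both are therefore modelled as transition relations. A state of the main loop is the
  pair \<open>(\<Omega>, A)\<close>.
\<close>

inductive bm_step ::
  "('x::finite) monom rel \<Rightarrow> 'x monom set set \<times> 'x edges \<Rightarrow> 'x monom set set \<times> 'x edges \<Rightarrow> bool"
  for gt where
  "\<lbrakk>\<sigma> \<in> \<Omega>; \<forall>\<tau>\<in>\<Omega>. card \<tau> \<le> card \<sigma>\<rbrakk> \<Longrightarrow>
   bm_step gt (\<Omega>, A)
     (\<Omega> - {\<sigma>, \<sigma> - sb gt \<sigma>}, if sb gt \<sigma> \<noteq> {} then insert (\<sigma>, \<sigma> - sb gt \<sigma>) A else A)"

inductive bm_prune :: "('x::finite) monom rel \<Rightarrow> 'x edges \<Rightarrow> 'x edges \<Rightarrow> bool"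
  for gt where
  "\<lbrakk>(\<sigma>, \<tau>) \<in> A; (\<sigma>', \<tau>) \<in> A; \<sigma> \<noteq> \<sigma>'; m \<in> sb gt \<sigma>; m' \<in> sb gt \<sigma>'; (m, m') \<in> gt\<rbrakk> \<Longrightarrow>
   bm_prune gt A (A - {(\<sigma>, \<tau>)})"

text \<open>
  \<open>bm_run G gt A A'\<close>: some complete run of the algorithm on the set \<open>G\<close> of generators produces
  the edge set \<open>A\<close> in the main loop and the final edge set \<open>A'\<close>.
\<close>

definition bm_run :: "('x::finite) monom set \<Rightarrow> 'x monom rel \<Rightarrow> 'x edges \<Rightarrow> 'x edges \<Rightarrow> bool" where
  "bm_run G gt A A' \<longleftrightarrow>
     (bm_step gt)\<^sup>*\<^sup>* ({\<sigma>. \<sigma> \<subseteq> G \<and> card \<sigma> \<ge> 3}, {}) ({}, A) \<and>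
     (bm_prune gt)\<^sup>*\<^sup>* A A' \<and> \<not> (\<exists>B. bm_prune gt A' B)"

definition potentially_type2 ::
  "('x::finite) monom rel \<Rightarrow> 'x edges \<Rightarrow> 'x monom set \<Rightarrow> bool" where
  "potentially_type2 gt A \<sigma> \<longleftrightarrow> sb gt \<sigma> \<noteq> {} \<and> (\<sigma>, \<sigma> - sb gt \<sigma>) \<in> A"

definition type2 :: "('x::finite) monom rel \<Rightarrow> 'x edges \<Rightarrow> 'x monom set \<Rightarrow> bool" where
  "type2 gt A' \<sigma> \<longleftrightarrow> sb gt \<sigma> \<noteq> {} \<and> (\<sigma>, \<sigma> - sb gt \<sigma>) \<in> A'"

text \<open>
  A run exists for every monomial ideal by \<open>finite_min_gens\<close> and \<open>bm_run_exists\<close> below, so the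
  quantification over runs is not vacuous.
\<close>

definition bridge_friendly ::
  "(('x::finite) monom \<Rightarrow>\<^sub>0 'k::field) set \<Rightarrow> 'x monom rel \<Rightarrow> bool" where
  "bridge_friendly I gt \<longleftrightarrow>
     (\<forall>A A'. bm_run (min_gens I) gt A A' \<longrightarrow>
        (\<forall>\<sigma>. potentially_type2 gt A \<sigma> \<longrightarrow> type2 gt A' \<sigma>))"


lemma mdvd_iff: "mdvd m n \<longleftrightarrow> (\<forall>i. Poly_Mapping.lookup m i \<le> Poly_Mapping.lookup n i)"
proof
  assume "\<forall>i. Poly_Mapping.lookup m i \<le> Poly_Mapping.lookup n i"
  then have "n = m + (n - m)"
    by (intro poly_mapping_eqI) (simp add: lookup_add lookup_minus)
  then show "mdvd m n" unfolding mdvd_def by blast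
qed (auto simp: mdvd_def lookup_add)

lemma lookup_mlcm: "Poly_Mapping.lookup (mlcm \<sigma>) i = (SUP m\<in>\<sigma>. Poly_Mapping.lookup m i)"
  unfolding mlcm_def by (subst lookup_Abs_poly_mapping) auto

lemma mlcm_dvd_iff:
  assumes "finite \<sigma>"
  shows "mdvd (mlcm \<sigma>) n \<longleftrightarrow> (\<forall>m\<in>\<sigma>. mdvd m n)"
proof (cases "\<sigma> = {}")
  case True
  then show ?thesis by (simp add: mdvd_iff lookup_mlcm Sup_nat_def)
next
  case False
  then have "(SUP m\<in>\<sigma>. Poly_Mapping.lookup m i) \<le> k \<longleftrightarrow> (\<forall>m\<in>\<sigma>. Poly_Mapping.lookup m i \<le> k)" for i k
    using assms by (simp add: cSup_eq_Max)
  then show ?thesis by (auto simp: mdvd_iff lookup_mlcm)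
qed

lemma module_times: "module ((*) :: 'a::comm_ring_1 \<Rightarrow> 'a \<Rightarrow> 'a)"
  by unfold_locales (simp_all add: algebra_simps)

lemma mon_mdvd_closed:
  assumes "monomial_ideal I" "mon n \<in> I" "mdvd n m"
  shows "mon m \<in> I"
proof -
  interpret module "(*) :: ('a monom \<Rightarrow>\<^sub>0 'b) \<Rightarrow> _" by (rule module_times)
  obtain M where I: "I = span (mon ` M)" using assms(1) by (auto simp: monomial_ideal_def)
  obtain u where "m = n + u" using assms(3) by (auto simp: mdvd_def)
  then have "mon m = mon u * (mon n :: 'a monom \<Rightarrow>\<^sub>0 'b)" by (simp add: mult_single add.commute)
  then show ?thesis using span_scale[of "mon n" _ "mon u"] assms(2) I by simp
qed

lemma mon_in_span:
  assumes "(mon m :: 'x monom \<Rightarrow>\<^sub>0 'k::field) \<in> module.span (*) (mon ` M)"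
  shows "\<exists>n\<in>M. mdvd n m"
proof -
  interpret module "(*) :: ('x monom \<Rightarrow>\<^sub>0 'k) \<Rightarrow> _" by (rule module_times)
  have "\<forall>t\<in>Poly_Mapping.keys p. \<exists>n\<in>M. mdvd n t" if "p \<in> span (mon ` M)" for p :: "'x monom \<Rightarrow>\<^sub>0 'k"
    using that
  proof (induction rule: span_induct_alt)
    case base
    then show ?case by simp
  next
    case (step c x y)
    obtain n where n: "x = mon n" "n \<in> M" using step by auto
    have "\<exists>n\<in>M. mdvd n t" if "t \<in> Poly_Mapping.keys (c * x)" for t
    proof -
      from that keys_mult[of c x] n obtain a where "t = n + a"
        by (fastforce simp: add.commute)
      then show ?thesis using n by (auto simp: mdvd_def)
    qed
    then show ?case using step keys_add[of "c * x" y] by blast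
  qed
  from this[OF assms] show ?thesis by simp
qed

lemma mdvd_size_less:
  fixes m n :: "('x::finite) monom"
  assumes "mdvd n m" "n \<noteq> m"
  shows "(\<Sum>i\<in>UNIV. Poly_Mapping.lookup n i) < (\<Sum>i\<in>UNIV. Poly_Mapping.lookup m i)"
proof -
  obtain i where "Poly_Mapping.lookup n i \<noteq> Poly_Mapping.lookup m i"
    using assms(2) by (meson poly_mapping_eqI)
  then have "Poly_Mapping.lookup n i < Poly_Mapping.lookup m i"
    using assms(1) by (simp add: mdvd_iff order.not_eq_order_implies_strict)
  then have "\<exists>i\<in>UNIV. Poly_Mapping.lookup n i < Poly_Mapping.lookup m i" by blast
  then show ?thesis using assms(1)
    by (intro sum_strict_mono_ex1) (simp_all add: mdvd_iff)
qed

lemma min_gens_below: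
  fixes I :: "(('x::finite) monom \<Rightarrow>\<^sub>0 'k::field) set"
  assumes "mon m \<in> I"
  shows "\<exists>n\<in>min_gens I. mdvd n m"
  using assms
proof (induction m rule: measure_induct_rule[where f = "\<lambda>m. \<Sum>i\<in>UNIV. Poly_Mapping.lookup m i"])
  case (less m)
  show ?case
  proof (cases "m \<in> min_gens I")
    case True
    then show ?thesis by (auto simp: mdvd_iff)
  next
    case False
    then obtain n where n: "mon n \<in> I" "mdvd n m" "n \<noteq> m" using less.prems by (auto simp: min_gens_def)
    obtain l where l: "l \<in> min_gens I" "mdvd l n"
      using less.IH[OF mdvd_size_less[OF n(2,3)] n(1)] by blast
    then have "mdvd l m" using n(2) by (auto simp: mdvd_def add.assoc)
    then show ?thesis using l(1) by blast
  qed
qed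

text \<open>
  The set \<open>min_gens I\<close> generates \<open>I\<close> and is contained in every set of monomials generating \<open>I\<close>.
\<close>

lemma span_min_gens:
  fixes I :: "(('x::finite) monom \<Rightarrow>\<^sub>0 'k::field) set"
  assumes "monomial_ideal I"
  shows "module.span (*) (mon ` min_gens I) = I"
proof -
  interpret module "(*) :: ('x monom \<Rightarrow>\<^sub>0 'k) \<Rightarrow> _" by (rule module_times)
  obtain M where I: "I = span (mon ` M)" using assms by (auto simp: monomial_ideal_def)
  have "mon m \<in> span (mon ` min_gens I)" if "m \<in> M" for m
  proof -
    have "mon m \<in> I" using that I by (simp add: span_base)
    then obtain n where n: "n \<in> min_gens I" "mdvd n m" using min_gens_below by blast
    have "monomial_ideal (span (mon ` min_gens I))" by (auto simp: monomial_ideal_def)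
    moreover have "mon n \<in> span (mon ` min_gens I)" using n(1) by (intro span_base imageI)
    ultimately show ?thesis using n(2) by (rule mon_mdvd_closed)
  qed
  then have "mon ` M \<subseteq> span (mon ` min_gens I)" by blast
  then have "I \<subseteq> span (mon ` min_gens I)" by (subst I) (rule span_minimal, auto)
  moreover have "mon ` min_gens I \<subseteq> I" by (auto simp: min_gens_def)
  then have "span (mon ` min_gens I) \<subseteq> I"
    by (rule span_minimal) (simp add: I)
  ultimately show ?thesis by simp
qed

lemma min_gens_least:
  fixes I :: "(('x::finite) monom \<Rightarrow>\<^sub>0 'k::field) set"
  assumes "module.span (*) (mon ` M) = I"
  shows "min_gens I \<subseteq> M"
proof
  interpret module "(*) :: ('x monom \<Rightarrow>\<^sub>0 'k) \<Rightarrow> _" by (rule module_times)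
  fix m assume m: "m \<in> min_gens I"
  then have "(mon m :: 'x monom \<Rightarrow>\<^sub>0 'k) \<in> span (mon ` M)" using assms by (simp add: min_gens_def)
  then obtain n where n: "n \<in> M" "mdvd n m" using mon_in_span by blast
  then have "mon n \<in> I" using assms by (auto intro: span_base)
  then show "m \<in> M" using m n by (auto simp: min_gens_def)
qed

lemma dickson_seq:
  fixes s :: "nat \<Rightarrow> 'x \<Rightarrow> nat"
  assumes "finite X"
  shows "\<exists>f :: nat \<Rightarrow> nat. strict_mono f \<and> (\<forall>i\<in>X. \<forall>a b. a \<le> b \<longrightarrow> s (f a) i \<le> s (f b) i)"
  using assms
proof induction
  case empty
  show ?case by (rule exI[of _ id]) (simp add: strict_mono_def)
next
  case (insert x X)
  then obtain f :: "nat \<Rightarrow> nat" where f: "strict_mono f" "\<forall>i\<in>X. \<forall>a b. a \<le> b \<longrightarrow> s (f a) i \<le> s (f b) i" by blast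
  define t where "t a = s (f a) x" for a
  have "\<exists>b\<ge>a. \<forall>c\<ge>b. t b \<le> t c" for a
  proof -
    define v where "v = (LEAST v. v \<in> t ` {a..})"
    have "v \<in> t ` {a..}" unfolding v_def by (rule LeastI[of _ "t a"]) simp
    then obtain b where b: "b \<ge> a" "t b = v" by auto
    have "v \<le> t c" if "c \<ge> b" for c unfolding v_def by (rule Least_le) (use that b in auto)
    then show ?thesis using b by auto
  qed
  then obtain h where h: "\<And>a. h a \<ge> a" "\<And>a c. c \<ge> h a \<Longrightarrow> t (h a) \<le> t c" by metis
  define g where "g = rec_nat (h 0) (\<lambda>_ r. h (Suc r))"
  have g0: "g 0 = h 0" and gS: "\<And>k. g (Suc k) = h (Suc (g k))" by (simp_all add: g_def)
  have g: "strict_mono g" using h(1) by (simp add: strict_mono_Suc_iff gS Suc_le_lessD)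
  have gh: "\<exists>a. g k = h a" for k by (cases k) (auto simp: g0 gS)
  have "t (g a) \<le> t (g b)" if "a \<le> b" for a b
    using gh[of a] h(2) strict_mono_less_eq[OF g, of a b] that by auto
  moreover have "strict_mono (f \<circ> g)" using f(1) g by (simp add: strict_mono_o)
  moreover have "g a \<le> g b" if "a \<le> b" for a b using g that by (simp add: strict_mono_less_eq)
  ultimately have "strict_mono (f \<circ> g) \<and>
      (\<forall>i\<in>insert x X. \<forall>a b. a \<le> b \<longrightarrow> s ((f \<circ> g) a) i \<le> s ((f \<circ> g) b) i)"
    using f(2) by (simp add: t_def)
  then show ?case by blast
qed

lemma finite_min_gens:
  fixes I :: "(('x::finite) monom \<Rightarrow>\<^sub>0 'k::field) set"
  shows "finite (min_gens I)"
proof (rule ccontr)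
  assume "infinite (min_gens I)"
  then obtain s :: "nat \<Rightarrow> 'x monom" where s: "inj s" "range s \<subseteq> min_gens I"
    using infinite_countable_subset by blast
  obtain f :: "nat \<Rightarrow> nat" where f: "strict_mono f"
    "\<forall>i. \<forall>a b. a \<le> b \<longrightarrow> Poly_Mapping.lookup (s (f a)) i \<le> Poly_Mapping.lookup (s (f b)) i"
    using dickson_seq[of UNIV "\<lambda>a. Poly_Mapping.lookup (s a)"] by auto
  then have "mdvd (s (f 0)) (s (f 1))" by (simp add: mdvd_iff)
  moreover have "s (f 0) \<in> min_gens I" "s (f 1) \<in> min_gens I" using s by auto
  ultimately have "s (f 0) = s (f 1)" by (auto simp: min_gens_def)
  then have "f 0 = f 1" using s(1) by (simp add: inj_eq)
  then show False using f(1) by (simp add: strict_mono_eq)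
qed

lemma bm_step_terminates:
  assumes "finite \<Omega>"
  shows "\<exists>A'. (bm_step gt)\<^sup>*\<^sup>* (\<Omega>, A) ({}, A') \<and> (finite A \<longrightarrow> finite A')"
  using assms
proof (induction \<Omega> arbitrary: A rule: finite_psubset_induct)
  case (psubset \<Omega>)
  show ?case
  proof (cases "\<Omega> = {}")
    case False
    have "Max (card ` \<Omega>) \<in> card ` \<Omega>" using False psubset.hyps by simp
    then obtain \<sigma> where \<sigma>: "\<sigma> \<in> \<Omega>" "card \<sigma> = Max (card ` \<Omega>)" by auto
    then have mx: "\<forall>\<tau>\<in>\<Omega>. card \<tau> \<le> card \<sigma>" using psubset.hyps by simp
    let ?\<Omega> = "\<Omega> - {\<sigma>, \<sigma> - sb gt \<sigma>}"
    let ?A = "if sb gt \<sigma> \<noteq> {} then insert (\<sigma>, \<sigma> - sb gt \<sigma>) A else A"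
    have "?\<Omega> \<subset> \<Omega>" using \<sigma> by auto
    from psubset.IH[OF this, of ?A] obtain A' where
      "(bm_step gt)\<^sup>*\<^sup>* (?\<Omega>, ?A) ({}, A')" "finite ?A \<longrightarrow> finite A'" by blast
    moreover have "bm_step gt (\<Omega>, A) (?\<Omega>, ?A)" by (rule bm_step.intros[OF \<sigma>(1) mx])
    ultimately show ?thesis by (auto intro: converse_rtranclp_into_rtranclp split: if_splits)
  qed auto
qed

lemma bm_prune_terminates:
  assumes "finite A"
  shows "\<exists>A'. (bm_prune gt)\<^sup>*\<^sup>* A A' \<and> \<not> (\<exists>B. bm_prune gt A' B)"
  using assms
proof (induction A rule: finite_psubset_induct)
  case (psubset A)
  show ?case
  proof (cases "\<exists>B. bm_prune gt A B")
    case True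
    then obtain B where B: "bm_prune gt A B" by blast
    then have "B \<subset> A" by cases auto
    from psubset.IH[OF this] B show ?thesis by (meson converse_rtranclp_into_rtranclp)
  qed auto
qed

lemma bm_run_exists:
  assumes "finite G"
  shows "\<exists>A A'. bm_run G gt A A'"
proof -
  have "finite {\<sigma>. \<sigma> \<subseteq> G \<and> card \<sigma> \<ge> 3}" using assms by simp
  from bm_step_terminates[OF this, of gt "{}"] show ?thesis
    unfolding bm_run_def using bm_prune_terminates by blast
qed

end

theory Submission
  imports Defs
begin

text \<open>
  Why no edge is ever pruned. Suppose that \<open>\<sigma> = \<tau> \<union> {m}\<close> and \<open>\<sigma>' = \<tau> \<union> {m'}\<close> are
  sources of edges with the same target \<open>\<tau>\<close>, where \<open>m >\<^sub>I m'\<close>. Since \<open>m'\<close> is the smallest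
  bridge of \<open>\<sigma>'\<close>, it is a true gap of \<open>\<tau>\<close>. By hypothesis it is then a true gap of \<open>\<sigma>\<close>,
  and since all bridges of \<open>\<sigma>\<close> are at least \<open>m\<close>, the smallest bridge of \<open>\<sigma> \<union> {m'}\<close> is \<open>m'\<close>
  (\<open>smallest_bridge_insert_true_gap\<close>). So \<open>\<sigma>\<close> is obtained from the larger set \<open>\<sigma> \<union> {m'}\<close> by
  removing its smallest bridge.

  This cannot happen to the source \<open>\<sigma>\<close> of an edge, for any ideal (\<open>source_has_no_upper_neighbour\<close>).
  Among all \<open>m\<close> that are the smallest bridge of \<open>\<sigma> \<union> {m}\<close>, take the least. The algorithm treats
  larger sets first. If it had processed \<open>\<sigma> \<union> {m}\<close>, it would have discarded \<open>\<sigma>\<close> as the target.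
  So it discarded \<open>\<sigma> \<union> {m}\<close> as the target of some \<open>\<sigma> \<union> {m, p}\<close> with smallest bridge \<open>p\<close>. There
  \<open>m\<close> is a bridge too, so \<open>m >\<^sub>I p\<close>; and \<open>p\<close> is the smallest bridge of \<open>\<sigma> \<union> {p}\<close> as well, because
  enlarging a set without changing its least common multiple preserves bridges. This contradicts
  the choice of \<open>m\<close>.
\<close>

section \<open>Bridges and least common multiples\<close>

lemma mlcm_sandwich:
  fixes \<rho> :: "('x::finite) monom set"
  assumes "finite \<rho>" "\<sigma> \<subseteq> \<tau>" "\<tau> \<subseteq> \<rho>" "mlcm \<sigma> = mlcm \<rho>"
  shows "mlcm \<tau> = mlcm \<rho>"
proof -
  have mono: "mdvd (mlcm a) (mlcm b)" if "a \<subseteq> b" "finite b" for a b :: "'x monom set"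
  proof -
    have "\<forall>m\<in>b. mdvd m (mlcm b)"
      using mlcm_dvd_iff[OF that(2), of "mlcm b"] by (simp add: mdvd_iff)
    then show ?thesis using that mlcm_dvd_iff[of a] finite_subset by blast
  qed
  have "mdvd (mlcm \<tau>) (mlcm \<rho>)" "mdvd (mlcm \<rho>) (mlcm \<tau>)"
    using mono[OF assms(3,1)] mono[OF assms(2)] assms finite_subset by auto
  then show ?thesis by (intro poly_mapping_eqI antisym) (simp_all add: mdvd_iff)
qed

lemma bridge_mono:
  assumes "finite \<tau>" "\<sigma> \<subseteq> \<tau>" "mlcm \<sigma> = mlcm \<tau>" "bridge \<sigma> n"
  shows "bridge \<tau> n"
  using assms mlcm_sandwich[of \<tau> "\<sigma> - {n}" "\<tau> - {n}"] by (auto simp: bridge_def)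

lemma sb_singleton:
  assumes "trans gt" "irrefl gt" "m \<in> sb gt \<sigma>"
  shows "sb gt \<sigma> = {m}"
proof -
  have "m' = m" if "m' \<in> sb gt \<sigma>" for m'
    using that assms unfolding sb_def irrefl_def by (metis (mono_tags, lifting) mem_Collect_eq transD)
  then show ?thesis using assms(3) by blast
qed

lemma sb_bridge: "m \<in> sb gt \<sigma> \<Longrightarrow> bridge \<sigma> m"
  by (simp add: sb_def)

lemma sb_less: "m \<in> sb gt \<sigma> \<Longrightarrow> bridge \<sigma> n \<Longrightarrow> n \<noteq> m \<Longrightarrow> (n, m) \<in> gt"
  by (simp add: sb_def)

text \<open>
  All bridges of \<open>insert p \<sigma>\<close> are bridges of \<open>\<pi>\<close>, because the two sets have the same least
  common multiple. So \<open>p\<close> has no new competitors.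
\<close>

lemma sb_subset:
  assumes "finite \<pi>" "insert p \<sigma> \<subseteq> \<pi>" "p \<notin> \<sigma>" "mlcm \<sigma> = mlcm \<pi>" "p \<in> sb gt \<pi>"
  shows "p \<in> sb gt (insert p \<sigma>)"
proof -
  have eq: "mlcm (insert p \<sigma>) = mlcm \<pi>"
    using mlcm_sandwich[of \<pi> \<sigma> "insert p \<sigma>"] assms by auto
  then have "bridge (insert p \<sigma>) p" using assms by (simp add: bridge_def)
  moreover have "bridge \<pi> n" if "bridge (insert p \<sigma>) n" for n
    using bridge_mono[OF assms(1,2) eq that] .
  ultimately show ?thesis using assms(5) by (auto simp: sb_def)
qed

lemma smallest_bridge_is_true_gap:
  assumes "trans gt" "irrefl gt" "m \<in> sb gt \<sigma>"
  shows "true_gap gt (\<sigma> - {m}) m"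
proof -
  have b: "bridge \<sigma> m" and ins: "insert m (\<sigma> - {m}) = \<sigma>"
    using assms(3) by (auto simp: sb_def bridge_def)
  have "(m, n) \<notin> gt" if "bridge \<sigma> n" for n
    using assms(1,2) sb_less[OF assms(3) that] unfolding irrefl_def by (metis transD)
  moreover have "gap (\<sigma> - {m}) m" using b ins by (simp add: gap_def bridge_def)
  ultimately show ?thesis using ins by (auto simp: true_gap_def)
qed

text \<open>
  Adding a true gap creates no new bridges below it. If it lies below all old bridges, it
  becomes the smallest one.
\<close>

lemma smallest_bridge_insert_true_gap:
  assumes "strict_linear_order_on G gt" "\<sigma> \<subseteq> G" "m' \<in> G"
    and "true_gap gt \<sigma> m'" "m \<in> sb gt \<sigma>" "(m, m') \<in> gt"
  shows "m' \<in> sb gt (insert m' \<sigma>)"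
proof -
  have tr: "trans gt" and ir: "irrefl gt" and tot: "total_on G gt"
    using assms(1) by (auto simp: strict_linear_order_on_def)
  have b: "bridge (insert m' \<sigma>) m'"
    using assms(4) by (simp add: true_gap_def gap_def bridge_def)
  have "(n, m') \<in> gt" if n: "bridge (insert m' \<sigma>) n" "n \<noteq> m'" for n
  proof (rule ccontr)
    assume "(n, m') \<notin> gt"
    moreover have "n \<in> G" using n assms by (auto simp: bridge_def)
    ultimately have less: "(m', n) \<in> gt" using tot n(2) assms(3) by (auto simp: total_on_def)
    then have "bridge \<sigma> n" using n(1) assms(4) by (simp add: true_gap_def)
    then have "n = m \<or> (n, m) \<in> gt" using sb_less[OF assms(5)] by blast
    moreover have "(m, n) \<in> gt" using tr assms(6) less by (rule transD)
    ultimately show False using tr ir unfolding irrefl_def by (metis transD)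
  qed
  then show ?thesis using b by (simp add: sb_def)
qed

section \<open>The edges selected by the main loop\<close>

text \<open>
  A subset leaves \<open>\<Omega>\<close> only by being processed, which makes it a source if it has a bridge, or
  as the target of an edge. Being a source and being a target exclude each other: targets have
  left \<open>\<Omega>\<close>, hence are never processed later, and the cardinality bound shows that a target
  cannot have been processed earlier.
\<close>

definition loop_invariant ::
  "('x::finite) monom rel \<Rightarrow> 'x monom set set \<Rightarrow> 'x monom set set \<Rightarrow> 'x edges \<Rightarrow> bool" where
  "loop_invariant gt \<Omega>\<^sub>0 \<Omega> A \<longleftrightarrow>
     \<Omega> \<subseteq> \<Omega>\<^sub>0 \<and>
     (\<forall>(\<sigma>, \<tau>) \<in> A. \<sigma> \<in> \<Omega>\<^sub>0 \<and> sb gt \<sigma> \<noteq> {} \<and> \<tau> = \<sigma> - sb gt \<sigma>) \<and>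
     (\<forall>\<sigma> \<in> Domain A. \<forall>\<rho>\<in>\<Omega>. card \<rho> \<le> card \<sigma>) \<and>
     Range A \<inter> \<Omega> = {} \<and>
     Domain A \<inter> Range A = {} \<and>
     (\<forall>\<rho> \<in> \<Omega>\<^sub>0 - \<Omega>. sb gt \<rho> \<noteq> {} \<longrightarrow> \<rho> \<in> Domain A \<union> Range A)"

lemma loop_invariant_step:
  assumes "loop_invariant gt \<Omega>\<^sub>0 \<Omega> A" "bm_step gt (\<Omega>, A) (\<Omega>', A')"
    and fin: "\<And>\<sigma>. \<sigma> \<in> \<Omega>\<^sub>0 \<Longrightarrow> finite \<sigma>"
  shows "loop_invariant gt \<Omega>\<^sub>0 \<Omega>' A'"
  using assms(2)
proof cases
  case (1 \<sigma>)
  have sub0: "\<Omega> \<subseteq> \<Omega>\<^sub>0"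
    and edges: "\<forall>(\<upsilon>, \<tau>) \<in> A. \<upsilon> \<in> \<Omega>\<^sub>0 \<and> sb gt \<upsilon> \<noteq> {} \<and> \<tau> = \<upsilon> - sb gt \<upsilon>"
    and large: "\<forall>\<upsilon> \<in> Domain A. \<forall>\<rho>\<in>\<Omega>. card \<rho> \<le> card \<upsilon>"
    and gone: "Range A \<inter> \<Omega> = {}"
    and disj: "Domain A \<inter> Range A = {}"
    and covered: "\<forall>\<rho> \<in> \<Omega>\<^sub>0 - \<Omega>. sb gt \<rho> \<noteq> {} \<longrightarrow> \<rho> \<in> Domain A \<union> Range A"
    using assms(1) by (simp_all add: loop_invariant_def)
  have \<sigma>: "\<sigma> \<in> \<Omega>" "\<sigma> \<in> \<Omega>\<^sub>0" and sub: "\<Omega>' \<subseteq> \<Omega>" using 1 sub0 by auto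
  show ?thesis
  proof (cases "sb gt \<sigma> = {}")
    case True
    have A': "A' = A" and \<Omega>': "\<Omega>' = \<Omega> - {\<sigma>}" using 1 True by auto
    have "\<forall>\<rho> \<in> \<Omega>\<^sub>0 - \<Omega>'. sb gt \<rho> \<noteq> {} \<longrightarrow> \<rho> \<in> Domain A \<union> Range A"
    proof (intro ballI impI)
      fix \<rho> assume "\<rho> \<in> \<Omega>\<^sub>0 - \<Omega>'" "sb gt \<rho> \<noteq> {}"
      then show "\<rho> \<in> Domain A \<union> Range A"
        using covered True \<Omega>' by (cases "\<rho> = \<sigma>") blast+
    qed
    moreover have "\<Omega>' \<subseteq> \<Omega>\<^sub>0" "Range A \<inter> \<Omega>' = {}" using sub sub0 gone by blast+
    moreover have "\<forall>\<upsilon> \<in> Domain A. \<forall>\<rho>\<in>\<Omega>'. card \<rho> \<le> card \<upsilon>" using large sub by blast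
    ultimately show ?thesis using edges disj unfolding loop_invariant_def A' by (intro conjI)
  next
    case False
    let ?\<tau> = "\<sigma> - sb gt \<sigma>"
    have A': "A' = insert (\<sigma>, ?\<tau>) A" and \<Omega>': "\<Omega>' = \<Omega> - {\<sigma>, ?\<tau>}" using 1 False by auto
    have "sb gt \<sigma> \<subseteq> \<sigma>" by (auto simp: sb_def bridge_def)
    then have smaller: "card ?\<tau> < card \<sigma>"
      using False fin[OF \<sigma>(2)] by (intro psubset_card_mono) auto
    have "?\<tau> \<notin> Domain A"
    proof
      assume "?\<tau> \<in> Domain A"
      then have "card \<sigma> \<le> card ?\<tau>" using large \<sigma>(1) by blast
      then show False using smaller by simp
    qed
    moreover have "\<sigma> \<notin> Range A" using gone \<sigma>(1) by blast
    moreover have "?\<tau> \<noteq> \<sigma>" using smaller by auto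
    ultimately have "Domain A' \<inter> Range A' = {}"
      using disj unfolding A' Domain_insert Range_insert by blast
    moreover have "\<forall>\<upsilon> \<in> Domain A'. \<forall>\<rho>\<in>\<Omega>'. card \<rho> \<le> card \<upsilon>"
      using large sub 1(4) unfolding A' Domain_insert by blast
    moreover have "Range A' \<inter> \<Omega>' = {}"
      using gone unfolding A' \<Omega>' Range_insert by blast
    moreover have "\<forall>(\<upsilon>, \<tau>) \<in> A'. \<upsilon> \<in> \<Omega>\<^sub>0 \<and> sb gt \<upsilon> \<noteq> {} \<and> \<tau> = \<upsilon> - sb gt \<upsilon>"
      using edges False \<sigma>(2) unfolding A' by simp
    moreover have "\<forall>\<rho> \<in> \<Omega>\<^sub>0 - \<Omega>'. sb gt \<rho> \<noteq> {} \<longrightarrow> \<rho> \<in> Domain A' \<union> Range A'"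
      using covered unfolding A' \<Omega>' Domain_insert Range_insert by blast
    moreover have "\<Omega>' \<subseteq> \<Omega>\<^sub>0" using sub sub0 by blast
    ultimately show ?thesis unfolding loop_invariant_def by (intro conjI)
  qed
qed

lemma loop_invariant_run:
  assumes "(bm_step gt)\<^sup>*\<^sup>* (\<Omega>\<^sub>0, {}) (\<Omega>, A)" "\<And>\<sigma>. \<sigma> \<in> \<Omega>\<^sub>0 \<Longrightarrow> finite \<sigma>"
  shows "loop_invariant gt \<Omega>\<^sub>0 \<Omega> A"
proof -
  have "loop_invariant gt \<Omega>\<^sub>0 (fst s) (snd s)" if "(bm_step gt)\<^sup>*\<^sup>* (\<Omega>\<^sub>0, {}) s" for s
    using that
  proof induction
    case base
    then show ?case by (simp add: loop_invariant_def)
  next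
    case (step s t)
    have "bm_step gt (fst s, snd s) (fst t, snd t)" using step.hyps(2) by simp
    from loop_invariant_step[OF step.IH this assms(2)] show ?case by simp
  qed
  from this[OF assms(1)] show ?thesis by simp
qed

text \<open>
  The least \<open>m\<close> with this property leads to a smaller one, namely the smallest bridge \<open>p\<close> of the
  set \<open>\<sigma> \<union> {m, p}\<close> whose edge removed \<open>\<sigma> \<union> {m}\<close> from \<open>\<Omega>\<close>; well-founded induction
  replaces the choice of the least one.
\<close>

lemma source_has_no_upper_neighbour:
  assumes "finite G" "trans gt" "irrefl gt"
    and inv: "loop_invariant gt {\<sigma>. \<sigma> \<subseteq> G \<and> card \<sigma> \<ge> 3} {} A"
    and src: "\<sigma> \<in> Domain A"
    and "m \<in> G" "m \<notin> \<sigma>" "m \<in> sb gt (insert m \<sigma>)"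
  shows False
proof -
  have edges: "\<And>\<upsilon> \<tau>. (\<upsilon>, \<tau>) \<in> A \<Longrightarrow>
      \<upsilon> \<subseteq> G \<and> card \<upsilon> \<ge> 3 \<and> sb gt \<upsilon> \<noteq> {} \<and> \<tau> = \<upsilon> - sb gt \<upsilon>"
    and disj: "Domain A \<inter> Range A = {}"
    and covered: "\<And>\<rho>. \<rho> \<subseteq> G \<Longrightarrow> card \<rho> \<ge> 3 \<Longrightarrow> sb gt \<rho> \<noteq> {} \<Longrightarrow> \<rho> \<in> Domain A \<union> Range A"
    using inv by (auto simp: loop_invariant_def)
  define less where "less = {(a, b). a \<in> G \<and> b \<in> G \<and> (b, a) \<in> gt}"
  have "wf less"
  proof (rule finite_acyclic_wf)
    show "finite less" by (rule finite_subset[of _ "G \<times> G"]) (auto simp: less_def assms(1))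
    have "trans less" using assms(2) by (auto simp: less_def trans_def)
    then show "acyclic less" using assms(3) by (auto simp: acyclic_def less_def irrefl_def)
  qed
  then show False using assms(6-8)
  proof (induction m rule: wf_induct_rule)
    case (less m)
    let ?\<rho> = "insert m \<sigma>"
    have \<sigma>: "\<sigma> \<subseteq> G" "card \<sigma> \<ge> 3" using edges src by auto
    have fin: "finite \<sigma>" using \<sigma>(1) assms(1) by (rule finite_subset)
    have \<rho>: "?\<rho> \<subseteq> G" "card ?\<rho> \<ge> 3" using \<sigma> fin less.prems(1,2) by auto
    have sb\<rho>: "sb gt ?\<rho> = {m}" using sb_singleton[OF assms(2,3) less.prems(3)] .
    have "?\<rho> \<notin> Domain A"
    proof
      assume "?\<rho> \<in> Domain A"
      then obtain \<tau> where \<tau>: "(?\<rho>, \<tau>) \<in> A" by blast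
      have "\<tau> = \<sigma>" using edges[OF \<tau>] sb\<rho> less.prems(2) by simp
      then show False using \<tau> disj src by blast
    qed
    then have "?\<rho> \<in> Range A" using covered[OF \<rho>] sb\<rho> by simp
    then obtain \<pi> where "(\<pi>, ?\<rho>) \<in> A" by blast
    from edges[OF this] have \<pi>: "\<pi> \<subseteq> G" "sb gt \<pi> \<noteq> {}" "?\<rho> = \<pi> - sb gt \<pi>" by simp_all
    then obtain p where p: "p \<in> sb gt \<pi>" by blast
    have fin\<pi>: "finite \<pi>" using \<pi>(1) assms(1) by (rule finite_subset)
    have bp: "bridge \<pi> p" using p by (rule sb_bridge)
    have \<rho>_eq: "?\<rho> = \<pi> - {p}" using \<pi>(3) sb_singleton[OF assms(2,3) p] by simp
    have bm: "bridge ?\<rho> m" using less.prems(3) by (rule sb_bridge)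
    have eq1: "mlcm ?\<rho> = mlcm \<pi>" using bp \<rho>_eq by (simp add: bridge_def)
    have eq2: "mlcm \<sigma> = mlcm ?\<rho>" using bm less.prems(2) by (simp add: bridge_def)
    have sub: "?\<rho> \<subseteq> \<pi>" "p \<notin> ?\<rho>" "p \<in> \<pi>" using \<rho>_eq bp by (auto simp: bridge_def)
    have "(m, p) \<in> gt"
      using sb_less[OF p bridge_mono[OF fin\<pi> sub(1) eq1 bm]] sub(2) by blast
    then have "(p, m) \<in> less" using sub(3) \<pi>(1) less.prems(1) by (auto simp: less_def)
    moreover have "p \<in> sb gt (insert p \<sigma>)"
      using sb_subset[OF fin\<pi> _ _ _ p] sub eq1 eq2 by auto
    ultimately show False using less.IH[of p] sub(2,3) \<pi>(1) by blast
  qed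
qed

section \<open>Bridge-friendliness\<close>

theorem lemma2p34:
  fixes I :: "(('x::finite) monom \<Rightarrow>\<^sub>0 'k::field) set"
    and gt :: "'x monom rel"
  assumes "monomial_ideal I"
    and "strict_linear_order_on (min_gens I) gt"
    and "\<And>\<sigma> m m'. \<lbrakk>\<sigma> \<subseteq> min_gens I; m \<in> min_gens I; m' \<in> min_gens I;
           (m', m) \<in> gt; true_gap gt \<sigma> m\<rbrakk> \<Longrightarrow> true_gap gt (\<sigma> \<union> {m'}) m"
  shows "bridge_friendly I gt"
proof -
  let ?G = "min_gens I"
  have tr: "trans gt" and ir: "irrefl gt"
    using assms(2) by (auto simp: strict_linear_order_on_def)
  have "A' = A" if run: "bm_run ?G gt A A'" for A A'
  proof -
    have inv: "loop_invariant gt {\<sigma>. \<sigma> \<subseteq> ?G \<and> card \<sigma> \<ge> 3} {} A"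
      using run unfolding bm_run_def
      by (intro loop_invariant_run) (auto intro: finite_subset[OF _ finite_min_gens])
    have "\<not> bm_prune gt A B" for B
    proof
      assume "bm_prune gt A B"
      then obtain \<sigma> \<sigma>' \<tau> m m' where e: "(\<sigma>, \<tau>) \<in> A" "(\<sigma>', \<tau>) \<in> A"
        and m: "m \<in> sb gt \<sigma>" "m' \<in> sb gt \<sigma>'" "(m, m') \<in> gt"
        by cases blast
      have sub: "\<sigma> \<subseteq> ?G" "\<sigma>' \<subseteq> ?G" and \<tau>: "\<tau> = \<sigma> - sb gt \<sigma>" "\<tau> = \<sigma>' - sb gt \<sigma>'"
        using inv e unfolding loop_invariant_def by auto
      have in_G: "m \<in> ?G" "m' \<in> ?G" and "m \<in> \<sigma>"
        using sub sb_bridge[OF m(1)] sb_bridge[OF m(2)] by (auto simp: bridge_def)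
      have \<tau>': "\<tau> = \<sigma> - {m}" "\<tau> = \<sigma>' - {m'}"
        using \<tau> sb_singleton[OF tr ir m(1)] sb_singleton[OF tr ir m(2)] by auto
      have "true_gap gt \<tau> m'" using smallest_bridge_is_true_gap[OF tr ir m(2)] \<tau>' by simp
      moreover have "\<tau> \<subseteq> ?G" using \<tau>' sub by auto
      ultimately have "true_gap gt (\<tau> \<union> {m}) m'" using assms(3) in_G m(3) by blast
      then have tg: "true_gap gt \<sigma> m'" using \<tau>' \<open>m \<in> \<sigma>\<close> by (simp add: insert_absorb)
      then have "m' \<notin> \<sigma>" by (simp add: true_gap_def gap_def)
      then show False
        using source_has_no_upper_neighbour[OF finite_min_gens tr ir inv _ in_G(2)] e(1)
          smallest_bridge_insert_true_gap[OF assms(2) sub(1) in_G(2) tg m(1,3)] by blast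
    qed
    then show ?thesis using run unfolding bm_run_def by (auto elim: converse_rtranclpE)
  qed
  then show ?thesis by (auto simp: bridge_friendly_def potentially_type2_def type2_def)
qed

end
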